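(* Let $\alpha\in\mathbb{R}$. For every $n\ge 1$, the operator $\hat\delta=\delta-a$ satisfies $\hat\delta^2=0$ on $C(\Delta_T^n;B_\alpha)$; that is, the composition $C(\Delta_T^n;B_\alpha)\xrightarrow{\hat\delta}C(\Delta_T^{n+1};B_\alpha)\xrightarrow{\hat\delta}C(\Delta_T^{n+2};B_\alpha)$ is zero.
   Context: Fix $T>0$. $(B_\alpha)_{\alpha\in\mathbb{R}}$ is a Banach scale, i.e. a family of Banach spaces such that for $\alpha\le\beta$ the embedding $B_\beta\hookrightarrow B_\alpha$ is continuous. $S=(S_t)_{t\ge0}$ is an analytic (in particular strongly continuous) semigroup of bounded linear operators acting on this scale, with $S_0=\mathrm{Id}$; for every $\alpha\in\mathbb{R}$, $\varepsilon\in(0,1)$ there is $C_{\alpha,\varepsilon,T}>0$ with $\|S_tx\|_{B_{\alpha+\varepsilon}}\le C_{\alpha,\varepsilon,T}t^{-\varepsilon}\|x\|_{B_\alpha}$ and $\|(S_t-\mathrm{Id})x\|_{B_\alpha}\le C_{\alpha,\varepsilon,T}t^{\varepsilon}\|x\|_{B_{\alpha+\varepsilon}}$ for all $t\in(0,T]$. For $n\ge1$, $\Delta_T^n:=\{(t_1,\dots,t_n)\in[0,T]^n: 0\le t_n\le\dots\le t_1\le T\}$, and $C(\Delta_T^n;B_\alpha)$ is the space of continuous maps $\Delta_T^n\to B_\alpha$. The coboundary $\delta:C(\Delta_T^n;B_\alpha)\to C(\Delta_T^{n+1};B_\alpha)$ is $(\delta g)_{t_1\dots t_{n+1}}:=\sum_{i=1}^{n+1}(-1)^i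 g_{t_1\dots\hat t_i\dots t_{n+1}}$ ($\hat t_i$ means the argument is omitted). With $a_{ts}:=S_{t-s}-\mathrm{Id}$ for $0\le s\le t\le T$, set $(ag)_{t_1\dots t_{n+1}}:=a_{t_1t_2}g_{t_2\dots t_{n+1}}$ and $\hat\delta:=\delta-a$. *)

theory Defs
  imports "HOL-Analysis.Analysis"
begin

section \<open>Banach scales\<close>

text \<open>
  The members of a scale are different spaces indexed by a real number, so they cannot be types.
  Since the embeddings are injective and compatible, all the spaces are taken to be linear
  subspaces of one real vector space (without topology), for instance of their union, each with
  its own norm; the embeddings are then inclusions. Complex Banach spaces are covered by
  restricting the scalars.
\<close>

locale normed_space_on =
  fixes V :: "'v::real_vector set" and N :: "'v \<Rightarrow> real"
  assumes subspace: "subspace V"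
    and norm_eq_zero: "x \<in> V \<Longrightarrow> N x = 0 \<longleftrightarrow> x = 0"
    and norm_scale: "x \<in> V \<Longrightarrow> N (c *\<^sub>R x) = \<bar>c\<bar> * N x"
    and norm_triangle: "x \<in> V \<Longrightarrow> y \<in> V \<Longrightarrow> N (x + y) \<le> N x + N y"

text \<open>
  The locale \<^locale>\<open>Metric_space\<close> demands nonnegativity and symmetry of the distance for all
  elements of the type, hence the value 0 outside the space.
\<close>

definition dist_on :: "'v::real_vector set \<Rightarrow> ('v \<Rightarrow> real) \<Rightarrow> 'v \<Rightarrow> 'v \<Rightarrow> real"
  where "dist_on V N x y = (if x \<in> V \<and> y \<in> V then N (x - y) else 0)"

context normed_space_on
begin

lemma norm_nonneg: "0 \<le> N x" if "x \<in> V"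
proof -
  have m: "(- 1) *\<^sub>R x \<in> V"
    using subspace that by (rule subspace_scale)
  have "N 0 = 0"
    using subspace norm_eq_zero subspace_0 by blast
  then have "0 \<le> N x + N ((- 1) *\<^sub>R x)"
    using norm_triangle[OF that m] by simp
  then show ?thesis
    using norm_scale[OF that, of "- 1"] by simp
qed

sublocale Metric_space V "dist_on V N"
proof
  fix x y z
  show "0 \<le> dist_on V N x y"
    by (auto simp: dist_on_def intro!: norm_nonneg subspace_diff subspace)
  show "dist_on V N x y = dist_on V N y x"
  proof (cases "x \<in> V \<and> y \<in> V")
    case True
    then have "N ((- 1) *\<^sub>R (y - x)) = N (y - x)"
      using norm_scale[of "y - x" "- 1"] subspace_diff[OF subspace, of y x] by simp
    with True show ?thesis
      by (simp add: dist_on_def)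
  qed (auto simp: dist_on_def)
  show "dist_on V N x y = 0 \<longleftrightarrow> x = y" if "x \<in> V" "y \<in> V"
    using that norm_eq_zero[of "x - y"] subspace_diff[OF subspace] by (simp add: dist_on_def)
  show "dist_on V N x z \<le> dist_on V N x y + dist_on V N y z" if "x \<in> V" "y \<in> V" "z \<in> V"
    using that norm_triangle[of "x - y" "y - z"] subspace_diff[OF subspace]
    by (simp add: dist_on_def)
qed

end

locale banach_space_on = normed_space_on +
  assumes complete: mcomplete

abbreviation norm_topology :: "'v::real_vector set \<Rightarrow> ('v \<Rightarrow> real) \<Rightarrow> 'v topology"
  where "norm_topology V N \<equiv> Metric_space.mtopology V (dist_on V N)"

locale banach_scale =
  fixes B :: "real \<Rightarrow> 'v::real_vector set" and N :: "real \<Rightarrow> 'v \<Rightarrow> real"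
  assumes banach: "banach_space_on (B \<alpha>) (N \<alpha>)"
    and embedding: "\<alpha> \<le> \<beta> \<Longrightarrow> B \<beta> \<subseteq> B \<alpha>"
    and embedding_continuous: "\<alpha> \<le> \<beta> \<Longrightarrow> \<exists>K. \<forall>x\<in>B \<beta>. N \<alpha> x \<le> K * N \<beta> x"


section \<open>Analytic semigroups\<close>

definition bounded_operator_on :: "'v::real_vector set \<Rightarrow> ('v \<Rightarrow> real) \<Rightarrow> ('v \<Rightarrow> 'v) \<Rightarrow> bool"
  where "bounded_operator_on V N f \<longleftrightarrow>
    f \<in> V \<rightarrow> V \<and>
    (\<forall>x\<in>V. \<forall>y\<in>V. f (x + y) = f x + f y) \<and>
    (\<forall>c. \<forall>x\<in>V. f (c *\<^sub>R x) = c *\<^sub>R f x) \<and>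
    (\<exists>K. \<forall>x\<in>V. N (f x) \<le> K * N x)"

definition strongly_continuous_semigroup_on ::
    "'v::real_vector set \<Rightarrow> ('v \<Rightarrow> real) \<Rightarrow> (real \<Rightarrow> 'v \<Rightarrow> 'v) \<Rightarrow> bool"
  where "strongly_continuous_semigroup_on V N S \<longleftrightarrow>
    (\<forall>t\<ge>0. bounded_operator_on V N (S t)) \<and>
    (\<forall>x\<in>V. S 0 x = x) \<and>
    (\<forall>s\<ge>0. \<forall>t\<ge>0. \<forall>x\<in>V. S (s + t) x = S s (S t x)) \<and>
    (\<forall>x\<in>V. continuous_map (top_of_set {0..}) (norm_topology V N) (\<lambda>t. S t x))"

text \<open>
  A semigroup on a real Banach space is analytic if its complexification extends analytically to
  a sector around the positive half-line. The pair \<open>(x, y)\<close> stands for \<open>x + i y\<close>. The norm below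
  is only real-homogeneous, but it is equivalent to every complexification norm, so boundedness
  and limits are the right ones. If the space is itself complex and the semigroup complex-linear,
  its complexification is the direct sum of the semigroup and its conjugate, so that analyticity
  in this sense is the usual one.
\<close>

definition cscale :: "complex \<Rightarrow> 'v \<times> 'v \<Rightarrow> 'v::real_vector \<times> 'v"
  where "cscale z p = (Re z *\<^sub>R fst p - Im z *\<^sub>R snd p, Re z *\<^sub>R snd p + Im z *\<^sub>R fst p)"

definition cnorm :: "('v \<Rightarrow> real) \<Rightarrow> 'v \<times> 'v \<Rightarrow> real"
  where "cnorm N p = N (fst p) + N (snd p)"

definition sector :: "real \<Rightarrow> complex set"
  where "sector \<theta> = {z. z \<noteq> 0 \<and> \<bar>Arg z\<bar> < \<theta>}"

definition analytic_semigroup_on ::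
    "'v::real_vector set \<Rightarrow> ('v \<Rightarrow> real) \<Rightarrow> (real \<Rightarrow> 'v \<Rightarrow> 'v) \<Rightarrow> bool"
  where "analytic_semigroup_on V N S \<longleftrightarrow>
    strongly_continuous_semigroup_on V N S \<and>
    (\<exists>\<theta> F. 0 < \<theta> \<and> \<theta> \<le> pi / 2 \<and>
      (\<forall>t\<ge>0. \<forall>x\<in>V. \<forall>y\<in>V. F (complex_of_real t) (x, y) = (S t x, S t y)) \<and>
      (\<forall>z\<in>sector \<theta>. bounded_operator_on (V \<times> V) (cnorm N) (F z) \<and>
         (\<forall>c. \<forall>p\<in>V \<times> V. F z (cscale c p) = cscale c (F z p))) \<and>
      (\<forall>z\<in>sector \<theta>. \<forall>w\<in>sector \<theta>. \<forall>p\<in>V \<times> V. F (z + w) p = F z (F w p)) \<and>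
      (\<forall>p\<in>V \<times> V. \<forall>z\<in>sector \<theta>. \<exists>D\<in>V \<times> V.
         ((\<lambda>w. cnorm N (cscale (inverse (w - z)) (F w p - F z p) - D)) \<longlongrightarrow> 0) (at z)) \<and>
      (\<forall>p\<in>V \<times> V. ((\<lambda>z. cnorm N (F z p - p)) \<longlongrightarrow> 0) (at 0 within sector \<theta>)))"

locale analytic_semigroup_on_scale = banach_scale B N
  for B :: "real \<Rightarrow> 'v::real_vector set" and N :: "real \<Rightarrow> 'v \<Rightarrow> real" +
  fixes T :: real and S :: "real \<Rightarrow> 'v \<Rightarrow> 'v"
  assumes T_pos: "0 < T"
    and analytic: "analytic_semigroup_on (B \<alpha>) (N \<alpha>) S"
    and estimates: "0 < \<epsilon> \<Longrightarrow> \<epsilon> < 1 \<Longrightarrow> \<exists>C>0. \<forall>t\<in>{0<..T}.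
      (\<forall>x\<in>B \<alpha>. S t x \<in> B (\<alpha> + \<epsilon>) \<and>
         N (\<alpha> + \<epsilon>) (S t x) \<le> C * t powr (- \<epsilon>) * N \<alpha> x) \<and>
      (\<forall>x\<in>B (\<alpha> + \<epsilon>). N \<alpha> (S t x - x) \<le> C * t powr \<epsilon> * N (\<alpha> + \<epsilon>) x)"


section \<open>Cochains and coboundaries\<close>

text \<open>
  An \<open>n\<close>-tuple is an extensional function on \<open>{1..n}\<close>. A map on the simplex is a function
  on all of \<open>nat \<Rightarrow> real\<close> of which only the values on the simplex matter.
\<close>

definition simplex_Delta :: "real \<Rightarrow> nat \<Rightarrow> (nat \<Rightarrow> real) set"
  where "simplex_Delta T n =
    {t \<in> {1..n} \<rightarrow>\<^sub>E {0..T}. \<forall>i\<in>{1..<n}. t (Suc i) \<le> t i}"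

definition cochains ::
    "real \<Rightarrow> nat \<Rightarrow> 'v::real_vector set \<Rightarrow> ('v \<Rightarrow> real) \<Rightarrow> ((nat \<Rightarrow> real) \<Rightarrow> 'v) set"
  where "cochains T n V N = {g. continuous_map
    (subtopology (product_topology (\<lambda>_. euclideanreal) {1..n}) (simplex_Delta T n))
    (norm_topology V N) g}"

text \<open>\<open>omit n i t\<close> deletes the \<open>i\<close>-th entry of the \<open>(n + 1)\<close>-tuple \<open>t\<close>.\<close>

definition omit :: "nat \<Rightarrow> nat \<Rightarrow> (nat \<Rightarrow> real) \<Rightarrow> nat \<Rightarrow> real"
  where "omit n i t = (\<lambda>j\<in>{1..n}. if j < i then t j else t (Suc j))"

definition delta :: "nat \<Rightarrow> ((nat \<Rightarrow> real) \<Rightarrow> 'v) \<Rightarrow> (nat \<Rightarrow> real) \<Rightarrow> 'v::real_vector"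
  where "delta n g t = (\<Sum>i = 1..n + 1. (- 1) ^ i *\<^sub>R g (omit n i t))"

definition a_incr :: "(real \<Rightarrow> 'v \<Rightarrow> 'v) \<Rightarrow> real \<Rightarrow> real \<Rightarrow> 'v \<Rightarrow> 'v::real_vector"
  where "a_incr S t s x = S (t - s) x - x"

definition a_op ::
    "(real \<Rightarrow> 'v \<Rightarrow> 'v) \<Rightarrow> nat \<Rightarrow> ((nat \<Rightarrow> real) \<Rightarrow> 'v) \<Rightarrow> (nat \<Rightarrow> real) \<Rightarrow> 'v::real_vector"
  where "a_op S n g t = a_incr S (t 1) (t 2) (g (omit n 1 t))"

definition hat_delta ::
    "(real \<Rightarrow> 'v \<Rightarrow> 'v) \<Rightarrow> nat \<Rightarrow> ((nat \<Rightarrow> real) \<Rightarrow> 'v) \<Rightarrow> (nat \<Rightarrow> real) \<Rightarrow> 'v::real_vector"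
  where "hat_delta S n g t = delta n g t - a_op S n g t"

end

theory Submission
  imports Defs
begin

text \<open>
  Since \<open>a\<^sub>t\<^sub>s = S\<^sub>t\<^sub>-\<^sub>s - Id\<close>, subtracting \<open>a g\<close> from \<open>\<delta> g\<close> cancels the term of \<open>\<delta> g\<close> that omits \<open>t\<^sub>1\<close>
  and puts \<open>- S (t\<^sub>1 - t\<^sub>2) (g (t\<^sub>2, t\<^sub>3, \<dots>))\<close> in its place. The twisted coboundary is therefore an
  ordinary alternating sum of face maps \<open>d\<^sub>i\<close> (\<open>hat_delta_eq_faces\<close>) in which only \<open>d\<^sub>1\<close> is twisted
  by the semigroup. These faces satisfy the presimplicial identities
  \<open>d\<^sub>j d\<^sub>i = d\<^sub>i d\<^sub>j\<^sub>-\<^sub>1\<close> for \<open>i < j\<close> (\<open>face_face\<close>): the only case that is not a statement about deleting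
  entries is \<open>i = 1\<close>, \<open>j = 2\<close>, and it is the semigroup law
  \<open>S (t\<^sub>1 - t\<^sub>3) = S (t\<^sub>1 - t\<^sub>2) S (t\<^sub>2 - t\<^sub>3)\<close>. As for every such family of faces, the terms of the
  double alternating sum cancel in pairs.

  That the twisted coboundary preserves continuity needs the joint continuity of
  \<open>(t, x) \<mapsto> S t x\<close> on bounded time intervals (\<open>semigroup_jointly_continuous\<close>). Strong continuity
  gives only continuity in each variable; the missing bound on the operator norms, uniform in
  time, comes from the Banach-Steinhaus theorem (\<open>uniform_boundedness\<close>), and this is where the
  completeness of the space enters.
\<close>

section \<open>Continuous maps into a normed space\<close>

context normed_space_on
begin

text \<open>
  This form turns continuity into a limit of real functions, to which the limit rules for real
  numbers apply; the spaces here are subsets of a type without topology, so those for normed types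
  do not.
\<close>

lemma continuous_map_iff_norm:
  "continuous_map X mtopology f \<longleftrightarrow>
    f \<in> topspace X \<rightarrow> V \<and> (\<forall>x\<in>topspace X. ((\<lambda>y. N (f y - f x)) \<longlongrightarrow> 0) (atin X x))"
proof (cases "f \<in> topspace X \<rightarrow> V")
  case True
  have "limitin mtopology f (f x) (atin X x) \<longleftrightarrow> ((\<lambda>y. N (f y - f x)) \<longlongrightarrow> 0) (atin X x)"
    if x: "x \<in> topspace X" for x
  proof -
    have ev: "\<forall>\<^sub>F y in atin X x. f y \<in> V"
      unfolding eventually_atin using True by (auto intro: exI[of _ "topspace X"])
    then have "\<forall>\<^sub>F y in atin X x. dist_on V N (f y) (f x) = N (f y - f x)"
      by eventually_elim (use True x in \<open>auto simp: dist_on_def\<close>)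
    then show ?thesis
      using ev True x unfolding limitin_metric_dist_null by (auto simp: tendsto_cong)
  qed
  with True show ?thesis
    by (simp add: continuous_map_atin)
next
  case False
  then show ?thesis
    using continuous_map_funspace[of X mtopology f] by auto
qed

lemma norm_diff_triangle: "\<bar>N x - N y\<bar> \<le> N (x - y)" if "x \<in> V" "y \<in> V"
proof -
  have d: "x - y \<in> V" "y - x \<in> V"
    using that by (auto intro: subspace_diff subspace)
  have "N (y - x) = N (x - y)"
    using norm_scale[OF d(1), of "- 1"] by simp
  then show ?thesis
    using norm_triangle[OF d(1) that(2)] norm_triangle[OF d(2) that(1)] by simp
qed

lemma continuous_map_norm: "continuous_map X euclideanreal (\<lambda>x. N (f x))"
  if f: "continuous_map X mtopology f"
  unfolding continuous_map_atin limitin_canonical_iff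
proof
  fix x assume x: "x \<in> topspace X"
  have V: "f \<in> topspace X \<rightarrow> V" and lim: "((\<lambda>y. N (f y - f x)) \<longlongrightarrow> 0) (atin X x)"
    using f x by (auto simp: continuous_map_iff_norm)
  have "\<forall>\<^sub>F y in atin X x. norm (N (f y) - N (f x)) \<le> N (f y - f x)"
    unfolding eventually_atin using V x
    by (auto intro!: exI[of _ "topspace X"] norm_diff_triangle)
  then have "((\<lambda>y. N (f y) - N (f x)) \<longlongrightarrow> 0) (atin X x)"
    using lim by (rule Lim_null_comparison)
  then show "((\<lambda>y. N (f y)) \<longlongrightarrow> N (f x)) (atin X x)"
    by (rule LIM_zero_cancel)
qed

lemma continuous_map_scale: "continuous_map X mtopology (\<lambda>x. c *\<^sub>R f x)"
  if f: "continuous_map X mtopology f"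
  unfolding continuous_map_iff_norm
proof (intro conjI ballI)
  have V: "f \<in> topspace X \<rightarrow> V"
    using f by (auto simp: continuous_map_iff_norm)
  then show "(\<lambda>x. c *\<^sub>R f x) \<in> topspace X \<rightarrow> V"
    by (auto intro!: subspace_scale subspace)
  fix x assume x: "x \<in> topspace X"
  have lim: "((\<lambda>y. N (f y - f x)) \<longlongrightarrow> 0) (atin X x)"
    using f x by (auto simp: continuous_map_iff_norm)
  have eq: "\<forall>\<^sub>F y in atin X x. N (c *\<^sub>R f y - c *\<^sub>R f x) = \<bar>c\<bar> * N (f y - f x)"
    unfolding eventually_atin scaleR_diff_right[symmetric] using V x
    by (auto intro!: exI[of _ "topspace X"] norm_scale subspace_diff subspace)
  show "((\<lambda>y. N (c *\<^sub>R f y - c *\<^sub>R f x)) \<longlongrightarrow> 0) (atin X x)"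
    using tendsto_mult_right_zero[OF lim, of "\<bar>c\<bar>"] by (simp add: tendsto_cong[OF eq])
qed

lemma continuous_map_add: "continuous_map X mtopology (\<lambda>x. f x + g x)"
  if f: "continuous_map X mtopology f" and g: "continuous_map X mtopology g"
  unfolding continuous_map_iff_norm
proof (intro conjI ballI)
  have V: "f \<in> topspace X \<rightarrow> V" "g \<in> topspace X \<rightarrow> V"
    using f g by (auto simp: continuous_map_iff_norm)
  then show "(\<lambda>x. f x + g x) \<in> topspace X \<rightarrow> V"
    by (auto intro!: subspace_add subspace)
  fix x assume x: "x \<in> topspace X"
  have "\<forall>\<^sub>F y in atin X x. norm (N (f y + g y - (f x + g x))) \<le> N (f y - f x) + N (g y - g x)"
    unfolding eventually_atin
  proof (intro disjI2 exI[of _ "topspace X"] conjI ballI)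
    fix y assume "y \<in> topspace X - {x}"
    then have "f y - f x \<in> V" "g y - g x \<in> V"
      using V x by (auto intro!: subspace_diff subspace)
    then have "N ((f y - f x) + (g y - g x)) \<le> N (f y - f x) + N (g y - g x)"
      and "0 \<le> N ((f y - f x) + (g y - g x))"
      by (auto intro!: norm_triangle norm_nonneg subspace_add subspace)
    then show "norm (N (f y + g y - (f x + g x))) \<le> N (f y - f x) + N (g y - g x)"
      by (simp add: add_diff_add)
  qed (use x in auto)
  moreover have "((\<lambda>y. N (f y - f x) + N (g y - g x)) \<longlongrightarrow> 0) (atin X x)"
    using f g x by (intro tendsto_add_zero) (auto simp: continuous_map_iff_norm)
  ultimately show "((\<lambda>y. N (f y + g y - (f x + g x))) \<longlongrightarrow> 0) (atin X x)"
    by (rule Lim_null_comparison)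
qed

lemma continuous_map_sum: "continuous_map X mtopology (\<lambda>x. \<Sum>i\<in>I. f i x)"
  if "finite I" "\<And>i. i \<in> I \<Longrightarrow> continuous_map X mtopology (f i)"
  using that
proof (induction I rule: finite_induct)
  case empty
  show ?case
    using subspace_0[OF subspace] by simp
next
  case (insert i I)
  then show ?case
    by (simp add: continuous_map_add)
qed


section \<open>Bounded operators and uniform boundedness\<close>

lemma bounded_operator_diff: "f (x - y) = f x - f y"
  if f: "bounded_operator_on V N f" and "x \<in> V" "y \<in> V"
proof -
  have "f (x + (- 1) *\<^sub>R y) = f x + f ((- 1) *\<^sub>R y)"
    using f that subspace_scale[OF subspace, of y "- 1"] unfolding bounded_operator_on_def by blast
  moreover have "f ((- 1) *\<^sub>R y) = (- 1) *\<^sub>R f y"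
    using f that unfolding bounded_operator_on_def by blast
  ultimately show ?thesis by simp
qed

lemma bounded_operator_sum: "f (\<Sum>i\<in>I. c i *\<^sub>R x i) = (\<Sum>i\<in>I. c i *\<^sub>R f (x i))"
  if f: "bounded_operator_on V N f" and "finite I" "\<And>i. i \<in> I \<Longrightarrow> x i \<in> V"
  using that(2,3)
proof (induction I rule: finite_induct)
  case empty
  have "0 \<in> V"
    by (rule subspace_0[OF subspace])
  then show ?case
    using bounded_operator_diff[OF f, of 0 0] by simp
next
  case (insert i I)
  have "(\<Sum>i\<in>I. c i *\<^sub>R x i) \<in> V" "c i *\<^sub>R x i \<in> V"
    using insert by (auto intro!: subspace_sum subspace_scale subspace)
  then have "f (c i *\<^sub>R x i + (\<Sum>i\<in>I. c i *\<^sub>R x i)) = c i *\<^sub>R f (x i) + f (\<Sum>i\<in>I. c i *\<^sub>R x i)"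
    using f insert.prems unfolding bounded_operator_on_def by (metis insertI1)
  then show ?case
    using insert by simp
qed

lemma bounded_operator_continuous: "continuous_map mtopology mtopology f"
  if f: "bounded_operator_on V N f"
  unfolding continuous_map_iff_norm topspace_mtopology
proof (intro conjI ballI)
  show fV: "f \<in> V \<rightarrow> V"
    using f by (simp add: bounded_operator_on_def)
  obtain K where K: "N (f x) \<le> K * N x" if "x \<in> V" for x
    using f unfolding bounded_operator_on_def by blast
  fix x assume x: "x \<in> V"
  have "\<forall>\<^sub>F y in atin mtopology x. norm (N (f y - f x)) \<le> K * N (y - x)"
    unfolding eventually_atin
  proof (intro disjI2 exI[of _ V] conjI ballI)
    fix y assume "y \<in> V - {x}"
    then have y: "y \<in> V" "y - x \<in> V"
      using x by (auto intro: subspace_diff subspace)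
    have "f (y - x) \<in> V"
      using fV y by auto
    then show "norm (N (f y - f x)) \<le> K * N (y - x)"
      using K[OF y(2)] norm_nonneg bounded_operator_diff[OF f y(1) x] by auto
  qed (use x in \<open>auto simp: openin_topspace[of mtopology, simplified]\<close>)
  moreover have "((\<lambda>y. N (y - x)) \<longlongrightarrow> 0) (atin mtopology x)"
    using x continuous_map_iff_norm[of mtopology "\<lambda>x. x"] by auto
  then have "((\<lambda>y. K * N (y - x)) \<longlongrightarrow> 0) (atin mtopology x)"
    by (rule tendsto_mult_right_zero)
  ultimately show "((\<lambda>y. N (f y - f x)) \<longlongrightarrow> 0) (atin mtopology x)"
    by (rule Lim_null_comparison)
qed

end

context banach_space_on
begin

text \<open>
  The sets \<open>A k\<close> of the points where the whole family is bounded by \<open>k\<close> are closed and cover the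
  space, so by Baire's theorem one of them contains a ball. Translating this ball to the origin
  costs a factor 2 in the bound, and scaling it gives the bound everywhere.
\<close>

lemma uniform_boundedness:
  assumes F: "\<And>f. f \<in> F \<Longrightarrow> bounded_operator_on V N f"
    and pointwise: "\<And>x. x \<in> V \<Longrightarrow> \<exists>K. \<forall>f\<in>F. N (f x) \<le> K"
  shows "\<exists>M\<ge>0. \<forall>f\<in>F. \<forall>x\<in>V. N (f x) \<le> M * N x"
proof -
  define A where "A k = {x \<in> V. \<forall>f\<in>F. N (f x) \<le> real k}" for k
  have closed: "closedin mtopology (A k)" for k
  proof -
    have "closedin mtopology {x \<in> topspace mtopology. N (f x) \<in> {..real k}}" if "f \<in> F" for f
      using continuous_map_norm[OF bounded_operator_continuous[OF F[OF that]]]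
      by (rule closedin_continuous_map_preimage) (simp add: closed_atMost)
    then have "closedin mtopology
        (\<Inter> (insert V ((\<lambda>f. {x \<in> topspace mtopology. N (f x) \<in> {..real k}}) ` F)))"
      using closedin_topspace[of mtopology] by (intro closedin_Inter) auto
    also have "\<Inter> (insert V ((\<lambda>f. {x \<in> topspace mtopology. N (f x) \<in> {..real k}}) ` F)) = A k"
      by (auto simp: A_def)
    finally show ?thesis .
  qed
  have V: "V = \<Union> (range A)"
  proof
    show "V \<subseteq> \<Union> (range A)"
    proof
      fix x assume x: "x \<in> V"
      then obtain K where K: "\<forall>f\<in>F. N (f x) \<le> K"
        using pointwise by blast
      obtain k where "K \<le> real k"
        using real_arch_simple by blast
      with K x have "x \<in> A k"
        unfolding A_def by force
      then show "x \<in> \<Union> (range A)"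
        by blast
    qed
  qed (auto simp: A_def)
  have "0 \<in> V"
    by (rule subspace_0[OF subspace])
  moreover have "mtopology interior_of V = V"
    using interior_of_topspace[of mtopology] by simp
  ultimately have "mtopology interior_of \<Union> (range A) \<noteq> {}"
    using V by auto
  then have "\<exists>k. mtopology interior_of (A k) \<noteq> {}"
    by (rule contrapos_np) (intro metric_Baire_category_alt[OF complete], use closed in auto)
  then obtain k where "mtopology interior_of (A k) \<noteq> {}"
    by blast
  then obtain x0 r where x0: "x0 \<in> V" and r: "r > 0" and ball: "mball x0 r \<subseteq> A k"
    by (auto simp: in_interior_of_mball)
  have "N (f x) \<le> 4 * real k / r * N x" if f: "f \<in> F" and x: "x \<in> V" for f x
  proof (cases "x = 0")
    case True
    have "f 0 = 0"
      using bounded_operator_diff[OF F[OF f], of 0 0] \<open>0 \<in> V\<close> by simp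
    then show ?thesis
      using True norm_eq_zero[OF \<open>0 \<in> V\<close>] by simp
  next
    case False
    then have Nx: "N x > 0"
      using x norm_eq_zero[OF x] norm_nonneg[OF x] by simp
    \<comment> \<open>Half the radius, so that \<open>x0 + c x\<close> stays in the open ball.\<close>
    define c where "c = r / (2 * N x)"
    have c: "c > 0"
      using r Nx by (simp add: c_def)
    have cx: "c *\<^sub>R x \<in> V" "x0 + c *\<^sub>R x \<in> V"
      using x x0 by (auto intro!: subspace_scale subspace_add subspace)
    have "N (x0 - (x0 + c *\<^sub>R x)) = r / 2"
      using norm_scale[OF x, of "- c"] c r Nx by (simp add: c_def)
    then have "x0 + c *\<^sub>R x \<in> mball x0 r" "x0 \<in> mball x0 r"
      using cx x0 r by (simp_all add: dist_on_def norm_eq_zero[of 0, simplified] subspace_0[OF subspace])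
    then have le: "N (f (x0 + c *\<^sub>R x)) \<le> real k" "N (f x0) \<le> real k"
      using ball f by (auto simp: A_def)
    have fV: "f x0 \<in> V" "f x \<in> V" "f (x0 + c *\<^sub>R x) \<in> V"
      using F[OF f] cx x x0 unfolding bounded_operator_on_def by blast+
    have "c *\<^sub>R f x = f (x0 + c *\<^sub>R x) - f x0"
      using F[OF f] x x0 cx by (simp add: bounded_operator_on_def)
    then have "c * N (f x) = N (f (x0 + c *\<^sub>R x) - f x0)"
      using norm_scale[OF fV(2), of c] c by simp
    also have "\<dots> \<le> N (f (x0 + c *\<^sub>R x)) + N ((- 1) *\<^sub>R f x0)"
      using norm_triangle[OF fV(3) subspace_scale[OF subspace fV(1), of "- 1"]] by simp
    also have "\<dots> \<le> 2 * real k"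
      using le norm_scale[OF fV(1), of "- 1"] by simp
    finally show ?thesis
      using r Nx by (simp add: c_def field_simps)
  qed
  then show ?thesis
    using r by (intro exI[of _ "4 * real k / r"]) auto
qed

lemma semigroup_locally_bounded:
  assumes S: "strongly_continuous_semigroup_on V N S"
  shows "\<exists>M\<ge>0. \<forall>t\<in>{0..T}. \<forall>x\<in>V. N (S t x) \<le> M * N x"
proof -
  have "\<exists>M\<ge>0. \<forall>f\<in>S ` {0..T}. \<forall>x\<in>V. N (f x) \<le> M * N x"
  proof (rule uniform_boundedness)
    show "bounded_operator_on V N f" if "f \<in> S ` {0..T}" for f
      using that S by (auto simp: strongly_continuous_semigroup_on_def)
    fix x assume x: "x \<in> V"
    have "continuous_map (top_of_set {0..}) euclideanreal (\<lambda>t. N (S t x))"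
      using S x by (intro continuous_map_norm) (simp add: strongly_continuous_semigroup_on_def)
    then have "continuous_on {0..T} (\<lambda>t. N (S t x))"
      by (auto intro: continuous_on_subset)
    then have "compact ((\<lambda>t. N (S t x)) ` {0..T})"
      by (intro compact_continuous_image) auto
    then show "\<exists>K. \<forall>f\<in>S ` {0..T}. N (f x) \<le> K"
      by (auto dest!: compact_imp_bounded simp: bounded_iff) (meson abs_le_D1)
  qed
  then show ?thesis by auto
qed

text \<open>
  Split \<open>S (\<tau> y) (f y) - S (\<tau> x) (f x)\<close> into \<open>S (\<tau> y) (f y - f x)\<close>, which is small by the uniform
  bound, and \<open>S (\<tau> y) (f x) - S (\<tau> x) (f x)\<close>, which is small by strong continuity at the fixed
  vector \<open>f x\<close>.
\<close>

lemma semigroup_jointly_continuous: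
  assumes S: "strongly_continuous_semigroup_on V N S"
    and \<tau>: "continuous_map X euclideanreal \<tau>" "\<tau> \<in> topspace X \<rightarrow> {0..T}"
    and f: "continuous_map X mtopology f"
  shows "continuous_map X mtopology (\<lambda>x. S (\<tau> x) (f x))"
  unfolding continuous_map_iff_norm
proof (intro conjI ballI)
  have op: "bounded_operator_on V N (S t)" if "t \<ge> 0" for t
    using S that by (simp add: strongly_continuous_semigroup_on_def)
  have SV: "S t x \<in> V" if "t \<ge> 0" "x \<in> V" for t x
    using op[OF that(1)] that(2) by (auto simp: bounded_operator_on_def)
  have fV: "f x \<in> V" and pos: "\<tau> x \<ge> 0" if "x \<in> topspace X" for x
    using f \<tau> that by (auto simp: continuous_map_iff_norm)
  then show "(\<lambda>x. S (\<tau> x) (f x)) \<in> topspace X \<rightarrow> V"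
    using SV by auto
  obtain M where M: "M \<ge> 0" "\<And>t x. t \<in> {0..T} \<Longrightarrow> x \<in> V \<Longrightarrow> N (S t x) \<le> M * N x"
    using semigroup_locally_bounded[OF S] by blast
  fix x assume x: "x \<in> topspace X"
  let ?h = "\<lambda>y. S (\<tau> y) (f x)"
  have "continuous_map X (top_of_set {0..}) \<tau>"
    using \<tau> by (auto simp: continuous_map_in_subtopology)
  moreover have "continuous_map (top_of_set {0..}) mtopology (\<lambda>t. S t (f x))"
    using S fV[OF x] by (simp add: strongly_continuous_semigroup_on_def)
  ultimately have "continuous_map X mtopology ?h"
    using continuous_map_compose[of X _ \<tau> mtopology "\<lambda>t. S t (f x)"] by (simp add: o_def)
  then have "((\<lambda>y. N (?h y - ?h x)) \<longlongrightarrow> 0) (atin X x)"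
    and "((\<lambda>y. N (f y - f x)) \<longlongrightarrow> 0) (atin X x)"
    using f x by (auto simp: continuous_map_iff_norm)
  then have lim: "((\<lambda>y. M * N (f y - f x) + N (?h y - ?h x)) \<longlongrightarrow> 0) (atin X x)"
    by (intro tendsto_add_zero tendsto_mult_right_zero)
  have "\<forall>\<^sub>F y in atin X x. norm (N (S (\<tau> y) (f y) - S (\<tau> x) (f x))) \<le>
      M * N (f y - f x) + N (?h y - ?h x)"
    unfolding eventually_atin
  proof (intro disjI2 exI[of _ "topspace X"] conjI ballI)
    fix y assume "y \<in> topspace X - {x}"
    then have y: "y \<in> topspace X" by simp
    have d: "f y - f x \<in> V" "?h y - ?h x \<in> V" "S (\<tau> y) (f y) - S (\<tau> x) (f x) \<in> V"
      using fV x y SV pos by (auto intro!: subspace_diff subspace)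
    have "N (S (\<tau> y) (f y - f x) + (?h y - ?h x)) \<le> N (S (\<tau> y) (f y - f x)) + N (?h y - ?h x)"
      using d SV pos y by (intro norm_triangle) auto
    also have "N (S (\<tau> y) (f y - f x)) \<le> M * N (f y - f x)"
      using d \<tau>(2) y by (intro M) auto
    finally show "norm (N (S (\<tau> y) (f y) - S (\<tau> x) (f x))) \<le>
        M * N (f y - f x) + N (?h y - ?h x)"
      using bounded_operator_diff[OF op[OF pos[OF y]] fV[OF y] fV[OF x]] norm_nonneg[OF d(3)]
      by simp
  qed (use x in auto)
  then show "((\<lambda>y. N (S (\<tau> y) (f y) - S (\<tau> x) (f x))) \<longlongrightarrow> 0) (atin X x)"
    using lim by (rule Lim_null_comparison)
qed

end


section \<open>Faces of simplices\<close>

lemma omit_simplex: "omit n i t \<in> simplex_Delta T n" if t: "t \<in> simplex_Delta T (n + 1)"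
proof -
  have step: "t (Suc k) \<le> t k" if "1 \<le> k" "k \<le> n" for k
    using t that by (auto simp: simplex_Delta_def)
  have "t k \<in> {0..T}" if "1 \<le> k" "k \<le> n + 1" for k
    using t that by (auto simp: simplex_Delta_def PiE_iff)
  moreover have "t (Suc (Suc k)) \<le> t k" if "1 \<le> k" "Suc k \<le> n" for k
    using step[of k] step[of "Suc k"] that by simp
  ultimately show ?thesis
    using step by (auto simp: simplex_Delta_def omit_def)
qed

lemma omit_omit:
  "omit n i (omit (n + 1) j t) = omit n (j - 1) (omit (n + 1) i t)" if "i < j"
  using that by (auto simp: omit_def fun_eq_iff)

abbreviation simplex_topology :: "real \<Rightarrow> nat \<Rightarrow> (nat \<Rightarrow> real) topology"
  where "simplex_topology T n \<equiv>
    subtopology (product_topology (\<lambda>_. euclideanreal) {1..n}) (simplex_Delta T n)"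

lemma topspace_simplex_topology: "topspace (simplex_topology T n) = simplex_Delta T n"
  by (auto simp: simplex_Delta_def)

lemma continuous_map_coordinate:
  "continuous_map (simplex_topology T n) euclideanreal (\<lambda>t. t i)" if "i \<in> {1..n}"
  using that by (intro continuous_map_from_subtopology continuous_map_product_projection)

lemma continuous_map_omit:
  "continuous_map (simplex_topology T (n + 1)) (simplex_topology T n) (omit n i)"
  unfolding continuous_map_in_subtopology continuous_map_componentwise
proof (intro conjI ballI)
  show "omit n i \<in> topspace (simplex_topology T (n + 1)) \<rightarrow> simplex_Delta T n"
    unfolding topspace_simplex_topology using omit_simplex by blast
  show "omit n i ` topspace (simplex_topology T (n + 1)) \<subseteq> extensional {1..n}"
    by (auto simp: omit_def)
  fix k assume k: "k \<in> {1..n}"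
  then have "(\<lambda>t. omit n i t k) = (if k < i then (\<lambda>t. t k) else (\<lambda>t. t (Suc k)))"
    by (auto simp: omit_def fun_eq_iff)
  then show "continuous_map (simplex_topology T (n + 1)) euclideanreal (\<lambda>t. omit n i t k)"
    using k continuous_map_coordinate[of _ "n + 1"] by auto
qed


section \<open>The twisted coboundary as an alternating sum of faces\<close>

definition face ::
    "(real \<Rightarrow> 'v \<Rightarrow> 'v) \<Rightarrow> nat \<Rightarrow> nat \<Rightarrow> ((nat \<Rightarrow> real) \<Rightarrow> 'v) \<Rightarrow> (nat \<Rightarrow> real) \<Rightarrow> 'v"
  where "face S n i g t =
    (if i = 1 then S (t 1 - t 2) (g (omit n 1 t)) else g (omit n i t))"

lemma hat_delta_eq_faces:
  fixes g :: "(nat \<Rightarrow> real) \<Rightarrow> 'v::real_vector"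
  shows "hat_delta S n g t = (\<Sum>i = 1..n + 1. (- 1) ^ i *\<^sub>R face S n i g t)"
proof -
  have split: "(\<Sum>i = 1..n + 1. h i) = h 1 + (\<Sum>i = 2..n + 1. h i)" for h :: "nat \<Rightarrow> 'v"
    using sum.atLeast_Suc_atMost[of 1 "n + 1" h] by (simp add: numeral_2_eq_2 del: sum.cl_ivl_Suc)
  have "(\<Sum>i = 2..n + 1. (- 1) ^ i *\<^sub>R face S n i g t) =
      (\<Sum>i = 2..n + 1. (- 1) ^ i *\<^sub>R g (omit n i t))"
    by (intro sum.cong) (auto simp: face_def)
  then show ?thesis
    unfolding hat_delta_def delta_def a_op_def a_incr_def split
    by (simp add: face_def del: sum.cl_ivl_Suc)
qed

lemma simplex_gap: "t 1 - t 2 \<in> {0..T}" if t: "t \<in> simplex_Delta T n" and n: "2 \<le> n"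
proof -
  have "t 1 \<in> {0..T}" "t 2 \<in> {0..T}"
    using t n by (auto simp: simplex_Delta_def PiE_iff)
  moreover have "t (Suc 1) \<le> t 1"
    using t n unfolding simplex_Delta_def by fastforce
  ultimately show ?thesis
    by (simp add: numeral_2_eq_2)
qed

text \<open>
  Only the faces that delete \<open>t\<^sub>1\<close> involve the semigroup. If \<open>i = 1\<close> and \<open>j > 2\<close>, deleting the \<open>j\<close>-th
  entry leaves \<open>t\<^sub>1\<close> and \<open>t\<^sub>2\<close> alone, so that both sides apply the same operator. If \<open>i = 1\<close> and
  \<open>j = 2\<close>, the left side applies \<open>S (t\<^sub>1 - t\<^sub>3)\<close>, as \<open>t\<^sub>2\<close> has been deleted, while the right side
  deletes \<open>t\<^sub>1\<close> and then \<open>t\<^sub>2\<close> and so applies \<open>S (t\<^sub>1 - t\<^sub>2)\<close> after \<open>S (t\<^sub>2 - t\<^sub>3)\<close>. The order of the entries makes both increments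
  nonnegative, as the semigroup law demands.
\<close>

lemma face_face:
  assumes S: "strongly_continuous_semigroup_on V N S"
    and g: "g \<in> simplex_Delta T n \<rightarrow> V"
    and t: "t \<in> simplex_Delta T (n + 2)"
    and n: "1 \<le> n" and i: "1 \<le> i" "i < j"
  shows "face S (n + 1) j (face S n i g) t = face S (n + 1) i (face S n (j - 1) g) t"
proof (cases "i = 1 \<and> j = 2")
  case True
  let ?x = "g (omit n 1 (omit (n + 1) 1 t))"
  have t1: "omit (n + 1) k t \<in> simplex_Delta T (n + 1)" for k
    using t omit_simplex[of t T "n + 1" k] by simp
  have "?x \<in> V"
    using g omit_simplex[OF t1] by blast
  moreover have "0 \<le> t 1 - t 2"
    using simplex_gap[OF t] n by simp
  moreover have "0 \<le> t 2 - t 3"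
    using simplex_gap[OF t1[of 1]] n by (simp add: omit_def numeral_eq_Suc)
  ultimately have "S ((t 1 - t 2) + (t 2 - t 3)) ?x = S (t 1 - t 2) (S (t 2 - t 3) ?x)"
    using S unfolding strongly_continuous_semigroup_on_def by blast
  then show ?thesis
    using True n omit_omit[of 1 2 n t] by (simp add: face_def omit_def numeral_eq_Suc)
next
  case False
  have "omit (n + 1) j t 1 = t 1" "omit (n + 1) j t 2 = t 2" if "2 < j"
    using n that by (auto simp: omit_def)
  then show ?thesis
    using False n i omit_omit[OF i(2), of n t] by (auto simp: face_def)
qed

text \<open>
  The map \<open>(j, i) \<mapsto> (i, j - 1)\<close> is a bijection from the pairs with \<open>i < j\<close> to those with \<open>j \<le> i\<close>. It
  preserves the terms and reverses their signs.
\<close>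

lemma alternating_double_sum_eq_0:
  fixes a :: "nat \<Rightarrow> nat \<Rightarrow> 'v::real_vector"
  assumes a: "\<And>i j. 1 \<le> i \<Longrightarrow> i < j \<Longrightarrow> j \<le> m + 1 \<Longrightarrow> a j i = a i (j - 1)"
  shows "(\<Sum>j = 1..m + 1. \<Sum>i = 1..m. (- 1) ^ (j + i) *\<^sub>R a j i) = 0"
proof -
  let ?f = "\<lambda>(j, i). (- 1) ^ (j + i) *\<^sub>R a j i"
  let ?P = "{1..m + 1} \<times> {1..m}"
  let ?U = "{(j, i) \<in> ?P. i < j}" and ?L = "{(j, i) \<in> ?P. j \<le> i}"
  have "finite ?U" "finite ?L"
    by (auto intro: finite_subset[of _ ?P])
  then have "sum ?f (?U \<union> ?L) = sum ?f ?U + sum ?f ?L"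
    by (rule sum.union_disjoint) auto
  moreover have "?U \<union> ?L = ?P"
    by auto
  moreover have "sum ?f ?U = (\<Sum>p\<in>?L. - ?f p)"
  proof (rule sum.reindex_bij_witness[where i = "\<lambda>(j, i). (i + 1, j)" and j = "\<lambda>(j, i). (i, j - 1)"])
    fix p assume "p \<in> ?U"
    then obtain j i where p: "p = (j, i)" and ij: "1 \<le> i" "i < j" "j \<le> m + 1"
      by auto
    then obtain k where k: "j = Suc k"
      using less_imp_Suc_add by blast
    show "- ?f (case p of (j, i) \<Rightarrow> (i, j - 1)) = ?f p"
      using a[OF ij] k p by (simp add: add.commute)
  qed auto
  ultimately show ?thesis
    by (simp add: sum.cartesian_product sum_negf)
qed

text \<open>
  The operators of the semigroup are linear on \<open>V\<close> only, so the first face commutes with the sum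
  only because all its terms are values in \<open>V\<close>.
\<close>

lemma face_hat_delta:
  assumes V: "banach_space_on V N" and S: "strongly_continuous_semigroup_on V N S"
    and g: "g \<in> simplex_Delta T n \<rightarrow> V"
    and t: "t \<in> simplex_Delta T (n + 2)" and n: "1 \<le> n"
  shows "face S (n + 1) j (hat_delta S n g) t =
    (\<Sum>i = 1..n + 1. (- 1) ^ i *\<^sub>R face S (n + 1) j (face S n i g) t)"
proof -
  interpret banach_space_on V N by (rule V)
  have op: "bounded_operator_on V N (S u)" if "u \<ge> 0" for u
    using S that by (simp add: strongly_continuous_semigroup_on_def)
  let ?s = "omit (n + 1) 1 t"
  have s: "?s \<in> simplex_Delta T (n + 1)"
    using t omit_simplex[of t T "n + 1"] by simp
  have "face S n i g ?s \<in> V" for i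
  proof -
    have "g (omit n k ?s) \<in> V" for k
      using g omit_simplex[OF s] by blast
    moreover have "0 \<le> ?s 1 - ?s 2"
      using simplex_gap[OF s] n by simp
    ultimately show ?thesis
      using op[of "?s 1 - ?s 2"] by (auto simp: face_def bounded_operator_on_def)
  qed
  moreover have "0 \<le> t 1 - t 2"
    using simplex_gap[OF t] n by simp
  ultimately have "S (t 1 - t 2) (\<Sum>i = 1..n + 1. (- 1) ^ i *\<^sub>R face S n i g ?s) =
      (\<Sum>i = 1..n + 1. (- 1) ^ i *\<^sub>R S (t 1 - t 2) (face S n i g ?s))"
    by (intro bounded_operator_sum op) auto
  then show ?thesis
    unfolding face_def[of S "n + 1"] hat_delta_eq_faces by (cases "j = 1") simp_all
qed

lemma hat_delta_cochain:
  assumes V: "banach_space_on V N" and S: "strongly_continuous_semigroup_on V N S"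
    and n: "1 \<le> n" and g: "g \<in> cochains T n V N"
  shows "hat_delta S n g \<in> cochains T (n + 1) V N"
proof -
  interpret banach_space_on V N by (rule V)
  let ?X = "simplex_topology T (n + 1)"
  have "continuous_map (simplex_topology T n) mtopology g"
    using g by (simp add: cochains_def)
  then have go: "continuous_map ?X mtopology (\<lambda>t. g (omit n i t))" for i
    using continuous_map_compose[OF continuous_map_omit] by (fastforce simp: o_def)
  have "continuous_map ?X euclideanreal (\<lambda>t. t 1 - t 2)"
    using n by (intro continuous_map_diff continuous_map_coordinate) auto
  moreover have "(\<lambda>t. t 1 - t 2) \<in> topspace ?X \<rightarrow> {0..T}"
    unfolding topspace_simplex_topology using n simplex_gap[where n = "n + 1"] by auto
  ultimately have "continuous_map ?X mtopology (\<lambda>t. S (t 1 - t 2) (g (omit n 1 t)))"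
    using semigroup_jointly_continuous[OF S _ _ go] by blast
  then have "continuous_map ?X mtopology (face S n i g)" for i
    using go[of i] by (cases "i = 1") (simp_all add: face_def[abs_def])
  then have "continuous_map ?X mtopology (\<lambda>t. \<Sum>i = 1..n + 1. (- 1) ^ i *\<^sub>R face S n i g t)"
    by (intro continuous_map_sum continuous_map_scale) auto
  then show ?thesis
    by (simp add: cochains_def hat_delta_eq_faces[abs_def] del: sum.cl_ivl_Suc)
qed

lemma hat_delta_hat_delta:
  assumes V: "banach_space_on V N" and S: "strongly_continuous_semigroup_on V N S"
    and g: "g \<in> simplex_Delta T n \<rightarrow> V"
    and t: "t \<in> simplex_Delta T (n + 2)" and n: "1 \<le> n"
  shows "hat_delta S (n + 1) (hat_delta S n g) t = 0"
proof -
  have "hat_delta S (n + 1) (hat_delta S n g) t =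
      (\<Sum>j = 1..n + 1 + 1. \<Sum>i = 1..n + 1.
        (- 1) ^ (j + i) *\<^sub>R face S (n + 1) j (face S n i g) t)"
    unfolding hat_delta_eq_faces[of S "n + 1"] face_hat_delta[OF V S g t n]
    by (simp add: scaleR_sum_right power_add del: sum.cl_ivl_Suc)
  also have "\<dots> = 0"
    by (rule alternating_double_sum_eq_0, rule face_face[OF S g t n])
  finally show ?thesis .
qed

theorem lemma2p2:
  fixes B :: "real \<Rightarrow> 'v::real_vector set" and N :: "real \<Rightarrow> 'v \<Rightarrow> real"
    and T :: real and S :: "real \<Rightarrow> 'v \<Rightarrow> 'v" and \<alpha> :: real and n :: nat
  assumes "analytic_semigroup_on_scale B N T S"
    and "1 \<le> n"
  shows "hat_delta S n \<in> cochains T n (B \<alpha>) (N \<alpha>) \<rightarrow> cochains T (n + 1) (B \<alpha>) (N \<alpha>) \<and>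
    hat_delta S (n + 1) \<in> cochains T (n + 1) (B \<alpha>) (N \<alpha>) \<rightarrow> cochains T (n + 2) (B \<alpha>) (N \<alpha>) \<and>
    (\<forall>g \<in> cochains T n (B \<alpha>) (N \<alpha>). \<forall>t \<in> simplex_Delta T (n + 2).
       hat_delta S (n + 1) (hat_delta S n g) t = 0)"
proof -
  interpret analytic_semigroup_on_scale B N T S by fact
  have V: "banach_space_on (B \<alpha>) (N \<alpha>)"
    by (rule banach)
  then interpret V: banach_space_on "B \<alpha>" "N \<alpha>" .
  have S: "strongly_continuous_semigroup_on (B \<alpha>) (N \<alpha>) S"
    using analytic by (simp add: analytic_semigroup_on_def)
  have "g \<in> simplex_Delta T n \<rightarrow> B \<alpha>" if "g \<in> cochains T n (B \<alpha>) (N \<alpha>)" for g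
    using that continuous_map_funspace[of "simplex_topology T n" V.mtopology g]
    unfolding cochains_def topspace_simplex_topology by auto
  moreover have "hat_delta S m g \<in> cochains T (m + 1) (B \<alpha>) (N \<alpha>)"
    if "1 \<le> m" "g \<in> cochains T m (B \<alpha>) (N \<alpha>)" for m g
    using hat_delta_cochain[OF V S that] .
  from this[of n] this[of "n + 1"] have
    "hat_delta S n \<in> cochains T n (B \<alpha>) (N \<alpha>) \<rightarrow> cochains T (n + 1) (B \<alpha>) (N \<alpha>)"
    "hat_delta S (n + 1) \<in> cochains T (n + 1) (B \<alpha>) (N \<alpha>) \<rightarrow> cochains T (n + 2) (B \<alpha>) (N \<alpha>)"
    using assms(2) by auto
  ultimately show ?thesis
    using hat_delta_hat_delta[OF V S _ _ assms(2)] by blast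
qed

end
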